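(* Let $p$ be a prime, and let $a\in\mathbb Z^+$ and $l\in\mathbb N$. If $n=(l+1)p^{a-1}-1+m\,\phi(p^a)$ for some $m\in\mathbb Z^+$, then $$\left\{\begin{matrix} n\\ r\end{matrix}\right\}_{l,p^{a}}\equiv(-1)^{m-1}\binom{m-1}l\pmod p\quad\text{for all } r\in\mathbb Z.$$
   Context: $\mathbb N=\{0,1,2,\ldots\}$; $\phi$ is Euler's totient function. Binomial coefficients: $\binom x0=1$, $\binom xk=x(x-1)\cdots(x-k+1)/k!$ for $k\in\mathbb Z^+$ (for rational $x$), and $\binom xk=0$ for negative integers $k$. For a prime $p$, $b\in\mathbb Z^+$, $l,n\in\mathbb N$ and $r\in\mathbb Z$, $$\left\{\begin{matrix} n\\ r\end{matrix}\right\}_{l,p^{b}}:=p^{-\left\lfloor\frac{n-p^{b-1}-lp^{b}}{\phi(p^{b})}\right\rfloor}\sum_{k\equiv r\,(\mathrm{mod}\ p^{b})}(-1)^k\binom nk\binom{(k-r)/p^{b}}l,$$ the sum over all integers $k\equiv r\pmod{p^b}$. These numbers are integers. *)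

theory Defs
  imports Complex_Main "HOL-Number_Theory.Number_Theory"
begin

text \<open>
  The argument \<open>b\<close> is meant to be positive. The sum runs over \<open>0 \<le> k \<le> n\<close> because the
  binomial coefficient of \<open>n\<close> over an integer \<open>k\<close> vanishes for all other \<open>k\<close>. The exponent of
  \<open>p\<close> may be of either sign, and all subtractions in it are rational ones.
\<close>

definition fleck_bracket :: "nat \<Rightarrow> nat \<Rightarrow> nat \<Rightarrow> nat \<Rightarrow> int \<Rightarrow> rat" where
  "fleck_bracket p b l n r =
     of_nat p powi
       (- \<lfloor>(of_nat n - of_nat (p ^ (b - 1)) - of_nat (l * p ^ b)) / (of_nat (totient (p ^ b)) :: rat)\<rfloor>) *
     (\<Sum>k | k \<le> n \<and> [int k = r] (mod int (p ^ b)).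
        (- 1) ^ k * of_nat (n choose k) * ((of_int (int k - r) / of_nat (p ^ b)) gchoose l))"

end

theory Submission
  imports Defs "HOL-Computational_Algebra.Polynomial"
begin

text \<open>
  Let \<open>q = p\<^sup>a\<close>, \<open>y = x - 1\<close> and \<open>T = x\<^sup>q - 1\<close> in \<open>\<int>[x]\<close>, and let \<open>\<lambda>\<^sub>l,\<^sub>r\<close> be the linear functional
  sending \<open>x\<^sup>k\<close> to \<open>(k - r)/q choose l\<close> if \<open>k \<equiv> r\<close> mod \<open>q\<close> and to \<open>0\<close> otherwise. The sum in the
  bracket is \<open>(-1)\<^sup>n \<lambda>\<^sub>l,\<^sub>r(y\<^sup>n)\<close>. Multiplying the argument by \<open>T\<close> turns \<open>\<lambda>\<^sub>l,\<^sub>r\<close> into \<open>\<lambda>\<^sub>l\<^sub>-\<^sub>1,\<^sub>r\<close>, and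
  multiplying it by \<open>x\<close> shifts \<open>r\<close>, so congruences that hold for all \<open>r\<close> survive multiplication by
  any \<open>g\<close>, at the cost of a factor \<open>g(1)\<close>. Since
  \<open>y\<^sup>q = T - p g y\<^bsup>q/p\<^esup> + p\<^sup>2 h y\<close> with \<open>g(1) = 1\<close>, the pair \<open>(n, l)\<close> is linked to
  \<open>(n - q, l - 1)\<close> and, with a factor \<open>-p\<close>, to \<open>(n - \<phi>(q), l)\<close>. This yields the divisibility of all the
  sums, which makes the \<open>p\<^sup>2\<close> term negligible, and then the claim by induction on \<open>m\<close>, the
  recursion being Pascal's rule for \<open>m - 1 choose l\<close>.
\<close>

section \<open>Integer-valued binomial coefficients\<close>

text \<open>
  The library restricts the type of \<open>gchoose\<close> to fields of characteristic \<open>0\<close>.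
\<close>

definition int_binomial :: "int \<Rightarrow> nat \<Rightarrow> int" where
  "int_binomial z k = (\<Prod>i = 0..<k. z - int i) div fact k"

lemma of_int_int_binomial:
  "(of_int (int_binomial z k) :: 'a :: field_char_0) = of_int z gchoose k"
proof -
  have "fact k dvd (\<Prod>i = 0..<k. z - int i)"
    by (rule dvdI[OF gbinomial_int_mult_fact[symmetric]])
  hence "fact k * int_binomial z k = (\<Prod>i = 0..<k. z - int i)"
    by (simp add: int_binomial_def)
  hence "(of_int (fact k * int_binomial z k) :: 'a) = of_int (\<Prod>i = 0..<k. z - int i)"
    by (simp only:)
  also have "\<dots> = fact k * (of_int z gchoose k)"
    by (simp add: gbinomial_mult_fact)
  finally show ?thesis
    by simp
qed

lemma int_binomial_0 [simp]: "int_binomial z 0 = 1"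
  by (simp add: int_binomial_def)

lemma int_binomial_Suc_Suc:
  "int_binomial (z + 1) (Suc k) = int_binomial z k + int_binomial z (Suc k)"
proof -
  have "(of_int (int_binomial (z + 1) (Suc k)) :: rat)
      = of_int (int_binomial z k + int_binomial z (Suc k))"
    by (simp add: of_int_int_binomial gbinomial_Suc_Suc)
  thus ?thesis
    by (simp only: of_int_eq_iff)
qed

section \<open>Weighted coefficient sums\<close>

text \<open>The weight is an argument of its own so that multiplying \<open>f\<close> by
  \<open>monom 1 q - 1\<close> can be traded for a change of weight.\<close>

definition weighted_sum :: "(int \<Rightarrow> int) \<Rightarrow> int poly \<Rightarrow> int \<Rightarrow> int" where
  "weighted_sum w f r = (\<Sum>k\<le>degree f. coeff f k * w (int k - r))"

lemma weighted_sum_eq: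
  assumes "degree f \<le> N"
  shows "weighted_sum w f r = (\<Sum>k\<le>N. coeff f k * w (int k - r))"
  unfolding weighted_sum_def
  by (rule sum.mono_neutral_left) (use assms in \<open>auto simp: coeff_eq_0\<close>)

lemma weighted_sum_0 [simp]: "weighted_sum w 0 r = 0"
  by (simp add: weighted_sum_def)

lemma weighted_sum_zero_weight [simp]: "weighted_sum (\<lambda>_. 0) f r = 0"
  by (simp add: weighted_sum_def)

lemma weighted_sum_add: "weighted_sum w (f + g) r = weighted_sum w f r + weighted_sum w g r"
proof -
  define N where "N = max (degree f) (degree g)"
  have "degree (f + g) \<le> N" "degree f \<le> N" "degree g \<le> N"
    by (auto simp: N_def degree_add_le_max)
  thus ?thesis
    by (simp add: weighted_sum_eq[of _ N] algebra_simps sum.distrib)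
qed

lemma weighted_sum_smult: "weighted_sum w (smult c f) r = c * weighted_sum w f r"
  by (subst weighted_sum_eq[of _ "degree f"])
     (simp_all add: weighted_sum_def sum_distrib_left mult.assoc)

lemma weighted_sum_uminus: "weighted_sum w (- f) r = - weighted_sum w f r"
  using weighted_sum_smult[of w "-1" f r] by simp

lemma weighted_sum_diff: "weighted_sum w (f - g) r = weighted_sum w f r - weighted_sum w g r"
  using weighted_sum_add[of w f "- g" r] by (simp add: weighted_sum_uminus)

lemma weighted_sum_pCons_0: "weighted_sum w (pCons 0 f) r = weighted_sum w f (r - 1)"
proof -
  have "weighted_sum w (pCons 0 f) r =
      (\<Sum>k\<le>Suc (degree f). coeff (pCons 0 f) k * w (int k - r))"
    by (rule weighted_sum_eq) (rule degree_pCons_le)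
  also have "\<dots> = weighted_sum w f (r - 1)"
    by (simp add: sum.atMost_Suc_shift weighted_sum_def algebra_simps del: sum.atMost_Suc)
  finally show ?thesis .
qed

lemma weighted_sum_monom_mult:
  "weighted_sum w (monom 1 n * f) r = weighted_sum w f (r - int n)"
proof (induction n arbitrary: r)
  case 0
  show ?case by simp
next
  case (Suc n)
  show ?case
    by (simp add: monom_Suc weighted_sum_pCons_0 Suc.IH diff_diff_eq add.commute)
qed

text \<open>Multiplication by \<open>monom 1 s\<close> is a shift of \<open>r\<close>, so this moves
  a factor \<open>monom 1 s - 1\<close> onto the weight as a forward difference.\<close>

lemma weighted_sum_shift_weight:
  "weighted_sum w f (r - s) - weighted_sum w f r = weighted_sum (\<lambda>z. w (z + s) - w z) f r"
  by (simp add: weighted_sum_def sum_subtractf[symmetric] algebra_simps)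

text \<open>A residue \<open>C\<close> independent of \<open>r\<close> survives the shifts caused by
  powers of x; linearity then leaves the coefficient sum of \<open>g\<close>, which is
  \<open>poly g 1\<close>.\<close>

lemma weighted_sum_mult_cong:
  assumes "\<And>r. [weighted_sum w f r = C] (mod M)"
  shows "[weighted_sum w (g * f) r = poly g 1 * C] (mod M)"
proof (induction g arbitrary: r)
  case 0
  show ?case by simp
next
  case (pCons c g)
  have "[c * weighted_sum w f r + weighted_sum w (g * f) (r - 1) = c * C + poly g 1 * C] (mod M)"
    by (intro cong_add cong_mult cong_refl assms pCons.IH)
  thus ?case
    by (simp add: weighted_sum_add weighted_sum_smult weighted_sum_pCons_0 algebra_simps)
qed

lemma weighted_sum_mult_dvd:
  assumes "\<And>r. M dvd weighted_sum w f r"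
  shows "M dvd weighted_sum w (g * f) r"
  using weighted_sum_mult_cong[of w f 0 M g r] assms by (simp add: cong_0_iff)

section \<open>Binomial weights on a residue class\<close>

definition binomial_weight :: "nat \<Rightarrow> nat \<Rightarrow> int \<Rightarrow> int" where
  "binomial_weight q l z = (if int q dvd z then int_binomial (z div int q) l else 0)"

lemma binomial_weight_0_diff: "binomial_weight q 0 (z + int q) - binomial_weight q 0 z = 0"
  by (simp add: binomial_weight_def)

text \<open>Pascal's rule on multiples of \<open>q\<close>; elsewhere every term vanishes.\<close>

lemma binomial_weight_Suc_diff:
  assumes "q > 0"
  shows "binomial_weight q (Suc l) (z + int q) - binomial_weight q (Suc l) z
      = binomial_weight q l z"
  using assms by (auto simp: binomial_weight_def int_binomial_Suc_Suc)

lemma weighted_sum_binomial_0_mult: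
  "weighted_sum (binomial_weight q 0) ((monom 1 q - 1) * f) r = 0"
  by (simp add: left_diff_distrib weighted_sum_diff weighted_sum_monom_mult
        weighted_sum_shift_weight binomial_weight_0_diff)

lemma weighted_sum_binomial_Suc_mult:
  assumes "q > 0"
  shows "weighted_sum (binomial_weight q (Suc l)) ((monom 1 q - 1) * f) r
      = weighted_sum (binomial_weight q l) f r"
  using assms
  by (simp add: left_diff_distrib weighted_sum_diff weighted_sum_monom_mult
        weighted_sum_shift_weight binomial_weight_Suc_diff)

section \<open>Powers of \<open>x - 1\<close>\<close>

text \<open>Expand \<open>(V + 1) ^ p\<close> with \<open>V = monom 1 c - 1\<close>: the inner
  binomial coefficients are divisible by \<open>p\<close>. Since \<open>V\<close> vanishes at 1,
  only the term \<open>i = 1\<close> contributes to \<open>poly g 1\<close>.\<close>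

lemma prime_power_minus_1:
  assumes "prime p"
  obtains g :: "int poly" where "poly g 1 = 1"
    "(monom 1 c - 1) ^ p = monom 1 (p * c) - 1 - smult (int p) ((monom 1 c - 1) * g)"
proof -
  define V :: "int poly" where "V = monom 1 c - 1"
  define g where "g = (\<Sum>i\<in>{1..<p}. smult (int ((p choose i) div p)) (V ^ (i - 1)))"
  have p: "p \<ge> 2" using assms prime_ge_2_nat by blast
  have "monom 1 (p * c) = (V + 1) ^ p"
    by (simp add: V_def monom_power mult.commute)
  also have "\<dots> = (\<Sum>i\<le>p. of_nat (p choose i) * V ^ i)"
    by (simp add: binomial_ring)
  also have "{..p} = insert 0 (insert p {1..<p})"
    using p by auto
  also have "(\<Sum>i\<in>\<dots>. of_nat (p choose i) * V ^ i) = 1 + V ^ p + (\<Sum>i\<in>{1..<p}. of_nat (p choose i) * V ^ i)"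
    using p by simp
  also have "(\<Sum>i\<in>{1..<p}. of_nat (p choose i) * V ^ i) = smult (int p) (V * g)"
  proof -
    have "of_nat (p choose i) * V ^ i
        = of_nat p * (V * smult (int ((p choose i) div p)) (V ^ (i - 1)))"
      if "i \<in> {1..<p}" for i
    proof -
      have "p dvd (p choose i)"
        using that assms by (intro dvd_choose_prime) auto
      hence "int p * int ((p choose i) div p) = int (p choose i)"
        by (metis dvd_mult_div_cancel of_nat_mult)
      moreover have "V * V ^ (i - 1) = V ^ i"
        using that by (cases i) auto
      ultimately show ?thesis
        by (simp add: of_nat_poly mult.commute[of "int ((p choose i) div p)"])
    qed
    hence "(\<Sum>i\<in>{1..<p}. of_nat (p choose i) * V ^ i) = of_nat p * (V * g)"
      by (simp add: g_def sum_distrib_left)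
    thus ?thesis
      by (simp add: of_nat_poly)
  qed
  finally have "V ^ p = monom 1 (p * c) - 1 - smult (int p) (V * g)"
    by (simp add: algebra_simps)
  moreover have "poly g 1 = 1"
  proof -
    have "poly g 1 = (\<Sum>i\<in>{1..<p}. if i = 1 then 1 else 0)"
      unfolding g_def poly_sum using p
      by (intro sum.cong) (auto simp: V_def poly_monom)
    also have "\<dots> = 1"
      using p by (subst sum.delta) auto
    finally show ?thesis .
  qed
  ultimately show ?thesis
    using that by (simp add: V_def)
qed

text \<open>Inner terms get one \<open>p\<close> from the binomial coefficient and one from
  \<open>smult\<close>; the last term has \<open>p \<ge> 2\<close> factors
  \<open>smult (int p) k\<close>. The factor \<open>k\<close> is kept because its root at 1 is
  exploited later.\<close>

lemma power_add_smult_prime: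
  fixes V k :: "int poly"
  assumes "prime p"
  obtains h where "(V + smult (int p) k) ^ p = V ^ p + smult (int p ^ 2) (k * h)"
proof -
  have p: "p \<ge> 2" using assms prime_ge_2_nat by blast
  have "of_nat p * smult (int p) k dvd (V + smult (int p) k) ^ p - V ^ p"
  proof -
    have "(V + smult (int p) k) ^ p - V ^ p
        = (\<Sum>i\<in>{1..p}. of_nat (p choose i) * smult (int p) k ^ i * V ^ (p - i))"
    proof -
      have "(smult (int p) k + V) ^ p
          = (\<Sum>i\<le>p. of_nat (p choose i) * smult (int p) k ^ i * V ^ (p - i))"
        by (rule binomial_ring)
      also have "{..p} = insert 0 {1..p}"
        by auto
      finally show ?thesis
        by (simp add: add.commute)
    qed
    also have "of_nat p * smult (int p) k dvd \<dots>"
    proof (rule dvd_sum)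
      fix i assume i: "i \<in> {1..p}"
      have "of_nat p * smult (int p) k dvd of_nat (p choose i) * smult (int p) k ^ i"
      proof (cases "i = p")
        case True
        have "smult (int p) k ^ 2 dvd smult (int p) k ^ i"
          using True p by (intro le_imp_power_dvd) auto
        moreover have "smult (int p) k ^ 2 = of_nat p * smult (int p) k * k"
          by (simp add: of_nat_poly power2_eq_square)
        hence "of_nat p * smult (int p) k dvd smult (int p) k ^ 2"
          by (rule dvdI)
        ultimately show ?thesis
          using True by (metis binomial_n_n dvd_trans mult_1 of_nat_1)
      next
        case False
        have "p dvd (p choose i)"
          using i False assms by (intro dvd_choose_prime) auto
        hence "(of_nat p :: int poly) dvd of_nat (p choose i)"
          by (metis dvd_def of_nat_mult)
        moreover have "smult (int p) k dvd smult (int p) k ^ i"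
          using i by (intro dvd_power) auto
        ultimately show ?thesis
          by (rule mult_dvd_mono)
      qed
      thus "of_nat p * smult (int p) k dvd of_nat (p choose i) * smult (int p) k ^ i * V ^ (p - i)"
        by (rule dvd_mult2)
    qed
    finally show ?thesis .
  qed
  then obtain h where "(V + smult (int p) k) ^ p - V ^ p = of_nat p * smult (int p) k * h"
    by (elim dvdE)
  hence "(V + smult (int p) k) ^ p = V ^ p + smult (int p ^ 2) (k * h)"
    by (simp add: of_nat_poly power2_eq_square algebra_simps)
  thus ?thesis by (rule that)
qed

text \<open>The Frobenius identity modulo \<open>p\<close>, lifted to the integers.\<close>

lemma linear_prime_power:
  assumes "prime p"
  obtains k :: "int poly" where "[:-1, 1:] ^ (p ^ b) = monom 1 (p ^ b) - 1 + smult (int p) k"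
proof -
  have "\<exists>k :: int poly. [:-1, 1:] ^ (p ^ b) = monom 1 (p ^ b) - 1 + smult (int p) k"
  proof (induction b)
    case 0
    have "[:-1, 1:] ^ (p ^ 0) = monom 1 (p ^ 0) - 1 + smult (int p) 0"
      by (simp add: monom_Suc monom_0 one_pCons)
    thus ?case by blast
  next
    case (Suc b)
    then obtain k :: "int poly"
      where k: "[:-1, 1:] ^ (p ^ b) = monom 1 (p ^ b) - 1 + smult (int p) k" by blast
    obtain g :: "int poly" where g: "poly g 1 = 1" "(monom 1 (p ^ b) - 1) ^ p =
        monom 1 (p * p ^ b) - 1 - smult (int p) ((monom 1 (p ^ b) - 1) * g)"
      using prime_power_minus_1[OF assms] .
    obtain h where h: "((monom 1 (p ^ b) - 1) + smult (int p) k) ^ p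
        = (monom 1 (p ^ b) - 1) ^ p + smult (int p ^ 2) (k * h)"
      using power_add_smult_prime[OF assms] .
    have "[:-1, 1:] ^ (p ^ Suc b) = ([:-1, 1:] ^ (p ^ b) :: int poly) ^ p"
      by (simp add: power_mult [symmetric] mult.commute)
    also have "\<dots> = monom 1 (p ^ Suc b) - 1
        + smult (int p) (smult (int p) (k * h) - (monom 1 (p ^ b) - 1) * g)"
      unfolding k h g by (simp add: power2_eq_square smult_diff_right)
    finally show ?case by blast
  qed
  thus ?thesis using that by blast
qed

text \<open>
  The factor \<open>x - 1\<close> next to \<open>h\<close> is what makes the error term small enough when \<open>p = 2\<close>.
\<close>

lemma linear_prime_power_refined:
  assumes "prime p"
  obtains g h :: "int poly" where "poly g 1 = 1"
    "[:-1, 1:] ^ (p * p ^ b) = monom 1 (p * p ^ b) - 1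
       - smult (int p) (g * [:-1, 1:] ^ (p ^ b)) + smult (int p ^ 2) (h * [:-1, 1:])"
proof -
  define V :: "int poly" where "V = monom 1 (p ^ b) - 1"
  define y :: "int poly" where "y = [:-1, 1:]"
  obtain k :: "int poly" where k: "y ^ (p ^ b) = V + smult (int p) k"
    using linear_prime_power[OF assms] unfolding V_def y_def .
  obtain g :: "int poly" where g: "poly g 1 = 1"
      "V ^ p = monom 1 (p * p ^ b) - 1 - smult (int p) (V * g)"
    using prime_power_minus_1[OF assms] unfolding V_def .
  obtain h where h: "(V + smult (int p) k) ^ p = V ^ p + smult (int p ^ 2) (k * h)"
    using power_add_smult_prime[OF assms] .
  have p: "p > 0" using assms prime_gt_0_nat by blast
  \<comment> \<open>Both \<open>y\<close> and \<open>V\<close> vanish at 1, hence so does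
    \<open>k\<close>, and \<open>y\<close> can be split off.\<close>
  have "poly (y ^ (p ^ b)) 1 = poly (V + smult (int p) k) 1"
    by (simp only: k)
  hence "poly k 1 = 0"
    using p by (simp add: y_def V_def poly_monom power_0_left)
  then obtain k' where k': "k = y * k'"
    unfolding poly_eq_0_iff_dvd y_def by (elim dvdE)
  have "y ^ (p * p ^ b) = (y ^ (p ^ b)) ^ p"
    by (simp add: power_mult [symmetric] mult.commute)
  also have "\<dots> = monom 1 (p * p ^ b) - 1 - smult (int p) (V * g) + smult (int p ^ 2) (k * h)"
    unfolding k h g ..
  also have "V = y ^ (p ^ b) - smult (int p) k"
    using k by simp
  also have "monom 1 (p * p ^ b) - 1 - smult (int p) ((y ^ (p ^ b) - smult (int p) k) * g)
        + smult (int p ^ 2) (k * h)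
      = monom 1 (p * p ^ b) - 1 - smult (int p) (g * y ^ (p ^ b))
        + smult (int p ^ 2) ((k' * (g + h)) * y)"
    unfolding k' by (simp add: algebra_simps power2_eq_square smult_add_right smult_diff_right)
  finally show ?thesis
    using that g(1) unfolding y_def by blast
qed


text \<open>The refined identity times a power of x - 1. Here \<open>(p - 1) * p ^ b\<close> is the
  totient of \<open>p * p ^ b\<close>, and \<open>g\<close>, \<open>h\<close> serve all
  \<open>n\<close> at once.\<close>

lemma linear_power_recursion:
  assumes "prime p"
  obtains g h :: "int poly" where "poly g 1 = 1"
    "\<And>n. n \<ge> p * p ^ b \<Longrightarrow> [:-1, 1:] ^ n = (monom 1 (p * p ^ b) - 1) * [:-1, 1:] ^ (n - p * p ^ b)
       - smult (int p) (g * [:-1, 1:] ^ (n - (p - 1) * p ^ b))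
       + smult (int p ^ 2) (h * [:-1, 1:] ^ (n - p * p ^ b + 1))"
proof -
  define y :: "int poly" where "y = [:-1, 1:]"
  obtain g h where g: "poly g 1 = 1" and
    gh: "y ^ (p * p ^ b) = monom 1 (p * p ^ b) - 1
       - smult (int p) (g * y ^ (p ^ b)) + smult (int p ^ 2) (h * y)"
    using linear_prime_power_refined[OF assms] unfolding y_def .
  have "y ^ n = (monom 1 (p * p ^ b) - 1) * y ^ (n - p * p ^ b)
       - smult (int p) (g * y ^ (n - (p - 1) * p ^ b))
       + smult (int p ^ 2) (h * y ^ (n - p * p ^ b + 1))" if n: "n \<ge> p * p ^ b" for n
  proof -
    define i where "i = n - p * p ^ b"
    have "p * p ^ b = p ^ b + (p - 1) * p ^ b"
      using prime_gt_0_nat[OF assms] by (cases p) auto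
    hence "n - (p - 1) * p ^ b = p ^ b + i"
      using n by (simp add: i_def)
    moreover have "y ^ n = y ^ (p * p ^ b) * y ^ i"
      using n by (simp add: i_def flip: power_add)
    ultimately show ?thesis
      unfolding gh i_def[symmetric] by (simp add: algebra_simps power_add)
  qed
  thus ?thesis
    using that g unfolding y_def by blast
qed

section \<open>Divisibility and leading term of the weighted sums\<close>

text \<open>Strong induction on \<open>n\<close> along the recursion: its first term lowers
  \<open>l\<close> and keeps \<open>e\<close>, the second pays \<open>p\<close> for
  \<open>e - 1\<close>, the third pays \<open>p ^ 2\<close> for \<open>e - 2\<close>.\<close>

lemma weighted_sum_linear_power_dvd:
  fixes p b l e n :: nat
  assumes "prime p" and "p ^ b + l * (p * p ^ b) + e * ((p - 1) * p ^ b) \<le> n"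
  shows "int p ^ e dvd weighted_sum (binomial_weight (p * p ^ b) l) ([:-1, 1:] ^ n) r"
proof -
  define c F q where "c = p ^ b" "F = (p - 1) * c" "q = p * c"
  define y :: "int poly" where "y = [:-1, 1:]"
  obtain g h where rec: "\<And>n. n \<ge> q \<Longrightarrow> y ^ n = (monom 1 q - 1) * y ^ (n - q)
       - smult (int p) (g * y ^ (n - F)) + smult (int p ^ 2) (h * y ^ (n - q + 1))"
    using linear_power_recursion[OF assms(1)] unfolding c_F_q_def y_def by metis
  have p: "p \<ge> 2" using assms(1) prime_ge_2_nat by blast
  have c: "c > 0" using p by (simp add: c_F_q_def)
  have q: "q = c + F" using p by (cases p) (auto simp: c_F_q_def)
  have F: "F \<ge> c" using p by (simp add: c_F_q_def)
  have "int p ^ e dvd weighted_sum (binomial_weight q l) (y ^ n) r"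
    if "c + l * q + e * F \<le> n" for n l e r
    using that
  proof (induction n arbitrary: l e r rule: less_induct)
    case (less n)
    show ?case
    proof (cases e)
      case 0
      thus ?thesis by simp
    next
      case (Suc e')
      have n: "n \<ge> c + l * q + F + e' * F"
        using less.prems Suc by simp
      have "int p ^ e dvd weighted_sum (binomial_weight q l) ((monom 1 q - 1) * y ^ (n - q)) r"
      proof (cases l)
        case 0
        thus ?thesis by (simp add: weighted_sum_binomial_0_mult)
      next
        case l: (Suc l')
        have "int p ^ e dvd weighted_sum (binomial_weight q l') (y ^ (n - q)) r"
          by (rule less.IH) (use less.prems l c q n in auto)
        thus ?thesis
          using c q l by (simp add: weighted_sum_binomial_Suc_mult)
      qed
      moreover have "int p ^ e dvd
          int p * weighted_sum (binomial_weight q l) (g * y ^ (n - F)) r"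
      proof -
        have "int p ^ e' dvd weighted_sum (binomial_weight q l) (g * y ^ (n - F)) r"
          by (intro weighted_sum_mult_dvd less.IH) (use n F c in auto)
        thus ?thesis
          using Suc by simp
      qed
      moreover have "int p ^ e dvd
          int p ^ 2 * weighted_sum (binomial_weight q l) (h * y ^ (n - q + 1)) r"
      proof (cases e')
        case 0
        thus ?thesis
          using Suc by (simp add: power2_eq_square)
      next
        case e': (Suc e'')
        \<comment> \<open>Since \<open>q = c + F\<close> and \<open>F \<ge> c\<close>, the exponent
          drops by less than \<open>2 * F\<close>, so the bound for \<open>e''\<close> still
          holds.\<close>
        have "int p ^ e'' dvd weighted_sum (binomial_weight q l) (h * y ^ (n - q + 1)) r"
          by (intro weighted_sum_mult_dvd less.IH) (use n F c q e' in auto)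
        hence "int p ^ 2 * int p ^ e'' dvd
            int p ^ 2 * weighted_sum (binomial_weight q l) (h * y ^ (n - q + 1)) r"
          by (rule mult_dvd_mono[OF dvd_refl])
        thus ?thesis
          using Suc e' by (simp add: power2_eq_square mult.assoc)
      qed
      moreover have "n \<ge> q"
        using n q by simp
      ultimately show ?thesis
        by (simp add: rec weighted_sum_add weighted_sum_diff weighted_sum_smult dvd_add dvd_diff)
    qed
  qed
  thus ?thesis
    using assms(2) unfolding c_F_q_def y_def by blast
qed

text \<open>Consecutive values in \<open>r\<close> differ by the sum for the \<open>q\<close>-th
  power, which \<open>p\<close> divides; so the sum is constant modulo \<open>p\<close> and can be
  read off at \<open>r = q - 1\<close>, where only the leading coefficient counts.\<close>

lemma weighted_sum_linear_power_base:
  assumes "prime p"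
  shows "[weighted_sum (binomial_weight (p * p ^ b) 0) ([:-1, 1:] ^ (p * p ^ b - 1)) r = 1] (mod int p)"
proof -
  define q where "q = p * p ^ b"
  define y :: "int poly" where "y = [:-1, 1:]"
  define S where "S = weighted_sum (binomial_weight q 0) (y ^ (q - 1))"
  have q: "q > 0" using assms prime_gt_0_nat by (simp add: q_def)
  obtain g h where gh: "y ^ q = monom 1 q - 1
       - smult (int p) (g * y ^ (p ^ b)) + smult (int p ^ 2) (h * y)"
    using linear_prime_power_refined[OF assms] unfolding q_def y_def by metis
  have step: "[S (s - 1) = S s] (mod int p)" for s
  proof -
    have "y ^ q = y * y ^ (q - 1)"
      using q by (cases q) auto
    also have "\<dots> = monom 1 1 * y ^ (q - 1) - y ^ (q - 1)"
      by (simp add: y_def monom_Suc monom_0 one_pCons)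
    finally have "weighted_sum (binomial_weight q 0) (y ^ q) s = S (s - 1) - S s"
      by (simp add: weighted_sum_diff weighted_sum_monom_mult S_def del: One_nat_def)
    moreover have "int p dvd weighted_sum (binomial_weight q 0) (y ^ q) s"
      unfolding gh using weighted_sum_binomial_0_mult[of q 1 s]
      by (simp add: weighted_sum_add weighted_sum_diff weighted_sum_smult power2_eq_square)
    ultimately show ?thesis
      by (simp add: cong_iff_dvd_diff)
  qed
  have const: "[S s = S (int (q - 1))] (mod int p)" for s
  proof (induction s rule: int_induct[where k = "int (q - 1)"])
    case base
    show ?case by simp
  next
    case (step1 i)
    thus ?case using step[of "i + 1"] by (metis add_diff_cancel_right' cong_sym cong_trans)
  next
    case (step2 i)
    thus ?case using step[of i] by (metis cong_trans)
  qed
  have "S (int (q - 1)) = (\<Sum>k\<le>q - 1. if k = q - 1 then 1 else 0)"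
  proof -
    have "binomial_weight q 0 (int k - int (q - 1)) = (if k = q - 1 then 1 else 0)" if "k \<le> q - 1" for k
    proof -
      have "int q dvd int k - int (q - 1) \<longleftrightarrow> int q dvd int (q - 1 - k)"
        using that by (subst dvd_diff_commute) (simp only: of_nat_diff of_nat_dvd_iff)
      also have "\<dots> \<longleftrightarrow> k = q - 1"
      proof (cases "k = q - 1")
        case False
        hence "0 < q - 1 - k" "q - 1 - k < q"
          using that by linarith+
        thus ?thesis
          using False by (simp only: of_nat_dvd_iff nat_dvd_not_less)
      qed simp
      finally show ?thesis
        by (simp add: binomial_weight_def)
    qed
    moreover have "degree (y ^ (q - 1)) = q - 1"
      by (simp add: y_def degree_power_eq)
    ultimately show ?thesis
      unfolding S_def weighted_sum_def
      by (intro sum.cong) (auto simp: y_def coeff_linear_poly_power)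
  qed
  hence "S (int (q - 1)) = 1" by simp
  with const[of r] show ?thesis
    by (simp add: S_def q_def y_def)
qed

text \<open>Here \<open>k\<close> stands for m - 1. Subtracting \<open>q\<close> from the exponent
  leads to \<open>(k - 1, l - 1)\<close>, subtracting \<open>F\<close> to \<open>(k - 1, l)\<close>.
  For \<open>l > k\<close> the modulus is 1 and nothing is claimed.\<close>

lemma weighted_sum_linear_power_cong:
  fixes p b l k :: nat
  assumes "prime p"
  shows "[weighted_sum (binomial_weight (p * p ^ b) l)
            ([:-1, 1:] ^ ((l + 1) * p ^ b - 1 + Suc k * ((p - 1) * p ^ b))) r
          = (- 1) ^ (k - l) * int (k choose l) * int p ^ (k - l)] (mod int p ^ (Suc k - l))"
proof -
  define c F q where "c = p ^ b" "F = (p - 1) * c" "q = p * c"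
  define y :: "int poly" where "y = [:-1, 1:]"
  obtain g h where g: "poly g 1 = 1" and
    rec: "\<And>n. n \<ge> q \<Longrightarrow> y ^ n = (monom 1 q - 1) * y ^ (n - q)
       - smult (int p) (g * y ^ (n - F)) + smult (int p ^ 2) (h * y ^ (n - q + 1))"
    using linear_power_recursion[OF assms] unfolding c_F_q_def y_def by metis
  have p: "p \<ge> 2" using assms prime_ge_2_nat by blast
  have c: "c > 0" using p by (simp add: c_F_q_def)
  have q: "q = c + F" using p by (cases p) (auto simp: c_F_q_def)
  have F: "F \<ge> c" using p by (simp add: c_F_q_def)
  define C where "C k l = (- 1) ^ (k - l) * int (k choose l) * int p ^ (k - l)" for k l
  have "[weighted_sum (binomial_weight q l) (y ^ ((l + 1) * c - 1 + Suc k * F)) r = C k l]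
          (mod int p ^ (Suc k - l))" for l r
  proof (induction k arbitrary: l r)
    case 0
    show ?case
    proof (cases "l = 0")
      case True
      have "c - Suc 0 + F = q - 1" using c q by simp
      thus ?thesis
        using True weighted_sum_linear_power_base[OF assms, of b r]
        by (simp add: C_def y_def c_F_q_def)
    next
      case False
      thus ?thesis by simp
    qed
  next
    case (Suc k)
    show ?case
    proof (cases "l \<le> Suc k")
      case False
      thus ?thesis by simp
    next
      case True
      define n where "n = (l + 1) * c - 1 + Suc (Suc k) * F"
      define M where "M = int p ^ (Suc (Suc k) - l)"
      define W where "W = weighted_sum (binomial_weight q l)"
      have n1: "n + 1 = l * c + c + 2 * F + k * F"
        using c by (simp add: n_def)
      have nq: "n \<ge> q" using n1 q F c by linarith
      \<comment> \<open>The contribution of the first term of the recursion, which vanishes for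
        \<open>l = 0\<close>.\<close>
      define C1 where "C1 = (case l of 0 \<Rightarrow> 0 | Suc l' \<Rightarrow> C k l')"
      have "[W ((monom 1 q - 1) * y ^ (n - q)) r = C1] (mod M)"
      proof (cases l)
        case 0
        thus ?thesis by (simp add: W_def C1_def weighted_sum_binomial_0_mult)
      next
        case l: (Suc l')
        have "n - q = (l' + 1) * c - 1 + Suc k * F"
          using n1 l q c by simp
        thus ?thesis
          using Suc.IH[of l' r] c q l
          by (simp add: W_def C1_def M_def weighted_sum_binomial_Suc_mult)
      qed
      moreover have "[int p * W (g * y ^ (n - F)) r = int p * C k l] (mod M)"
      proof -
        have "n - F = (l + 1) * c - 1 + Suc k * F"
          using n1 c by simp
        hence "[W (g * y ^ (n - F)) r = poly g 1 * C k l] (mod int p ^ (Suc k - l))"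
          unfolding W_def using Suc.IH[of l] by (intro weighted_sum_mult_cong) simp
        hence "[int p * W (g * y ^ (n - F)) r = int p * C k l] (mod (int p * int p ^ (Suc k - l)))"
          using g by (simp add: cong_cmult_leftI)
        thus ?thesis
          using True by (simp add: M_def Suc_diff_le)
      qed
      moreover have "[int p ^ 2 * W (h * y ^ (n - q + 1)) r = 0] (mod M)"
      proof (cases "l = Suc k")
        case True
        thus ?thesis by (simp add: M_def cong_0_iff power2_eq_square)
      next
        case False
        with True have l: "l \<le> k" by simp
        then obtain j where j: "k = l + j" using le_Suc_ex by blast
        \<comment> \<open>The exponent equals \<open>l * c + (k + 1) * F\<close>, which is at least
          \<open>c + l * q + (k - l) * F\<close> because \<open>F \<ge> c\<close>.\<close>
        have "int p ^ (k - l) dvd W (y ^ (n - q + 1)) s" for s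
          unfolding W_def y_def c_F_q_def
          by (rule weighted_sum_linear_power_dvd[OF assms],
              fold c_F_q_def(1), fold c_F_q_def(2,3))
             (use n1 nq q F j in \<open>simp add: algebra_simps\<close>)
        hence "int p ^ (k - l) dvd W (h * y ^ (n - q + 1)) r"
          unfolding W_def by (rule weighted_sum_mult_dvd)
        hence "int p ^ 2 * int p ^ (k - l) dvd int p ^ 2 * W (h * y ^ (n - q + 1)) r"
          by (rule mult_dvd_mono[OF dvd_refl])
        also have "int p ^ 2 * int p ^ (k - l) = M"
          using l by (simp add: M_def Suc_diff_le power2_eq_square)
        finally show ?thesis by (simp add: cong_0_iff)
      qed
      ultimately have "[W ((monom 1 q - 1) * y ^ (n - q)) r - int p * W (g * y ^ (n - F)) r
          + int p ^ 2 * W (h * y ^ (n - q + 1)) r = C1 - int p * C k l + 0] (mod M)"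
        by (intro cong_add cong_diff)
      also have "C1 - int p * C k l + 0 = C (Suc k) l"
      \<comment> \<open>For \<open>l = Suc k\<close> the truncated \<open>k - l\<close> is harmless,
        as \<open>k choose l = 0\<close>. Otherwise this is Pascal's rule, with
        \<open>- int p\<close> absorbed into the sign and the power.\<close>
      proof (cases "l = Suc k")
        case True
        thus ?thesis by (simp add: C1_def C_def)
      next
        case False
        with True obtain j where "k = l + j" using le_Suc_ex[of l k] by auto
        thus ?thesis
          by (cases l) (simp_all add: C1_def C_def Suc_diff_le algebra_simps)
      qed
      finally show ?thesis
        using nq unfolding n_def[symmetric] M_def[symmetric]
        by (simp add: rec[of n] W_def weighted_sum_add weighted_sum_diff weighted_sum_smult)
    qed
  qed
  thus ?thesis
    by (simp add: C_def c_F_q_def y_def)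
qed

section \<open>From weighted sums to the bracket\<close>

text \<open>The coefficients of the power of x - 1 carry the sign \<open>(- 1) ^ (n - k)\<close>;
  the factor \<open>(- 1) ^ n\<close> turns it into \<open>(- 1) ^ k\<close>.\<close>

lemma fleck_bracket_eq_weighted_sum:
  assumes "prime p"
  shows "fleck_bracket p b l n r =
     of_nat p powi
       (- \<lfloor>(of_nat n - of_nat (p ^ (b - 1)) - of_nat (l * p ^ b)) / (of_nat (totient (p ^ b)) :: rat)\<rfloor>) *
     of_int ((- 1) ^ n * weighted_sum (binomial_weight (p ^ b) l) ([:-1, 1:] ^ n) r)"
proof -
  define q where "q = p ^ b"
  have q: "q > 0" using assms prime_gt_0_nat by (simp add: q_def)
  have "(of_int ((- 1) ^ n * weighted_sum (binomial_weight q l) ([:-1, 1:] ^ n) r) :: rat)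
      = (\<Sum>k\<le>n. (- 1) ^ n * (of_nat (n choose k) * (- 1) ^ (n - k)
           * of_int (binomial_weight q l (int k - r))))"
    by (simp add: weighted_sum_def degree_power_eq coeff_linear_poly_power sum_distrib_left)
  also have "\<dots> = (\<Sum>k\<le>n. if [int k = r] (mod int q)
        then (- 1) ^ k * of_nat (n choose k) * ((of_int (int k - r) / of_nat q) gchoose l) else 0)"
  proof (rule sum.cong[OF refl])
    fix k assume k: "k \<in> {..n}"
    have sign: "(- 1) ^ n * (- 1) ^ (n - k) = ((- 1) ^ k :: rat)"
      using k by (simp add: minus_one_power_iff)
    show "(- 1) ^ n * (of_nat (n choose k) * (- 1) ^ (n - k)
           * of_int (binomial_weight q l (int k - r))) =
        (if [int k = r] (mod int q)
         then (- 1) ^ k * of_nat (n choose k) * ((of_int (int k - r) / of_nat q) gchoose l)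
         else (0 :: rat))"
    proof (cases "int q dvd int k - r")
      case True
      then obtain t where t: "int k - r = int q * t" by (elim dvdE)
      have "of_int (int k - r) / of_nat q = (of_int t :: rat)"
        using q by (simp add: t)
      thus ?thesis
        using True q t sign
        by (simp add: binomial_weight_def cong_iff_dvd_diff of_int_int_binomial mult_ac)
    next
      case False
      thus ?thesis
        by (simp add: binomial_weight_def cong_iff_dvd_diff)
    qed
  qed
  also have "\<dots> = (\<Sum>k | k \<le> n \<and> [int k = r] (mod int q).
      (- 1) ^ k * of_nat (n choose k) * ((of_int (int k - r) / of_nat q) gchoose l))"
    by (subst sum.inter_filter [symmetric]) (auto intro!: sum.cong)
  finally show ?thesis
    by (simp add: fleck_bracket_def q_def)
qed

theorem theorem1p5:
  fixes p a l m n :: nat and r :: int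
  assumes "prime p" and "a \<ge> 1" and "m \<ge> 1"
    and "n = (l + 1) * p ^ (a - 1) - 1 + m * totient (p ^ a)"
  shows "\<exists>z :: int. fleck_bracket p a l n r = of_int z \<and>
           [z = (- 1) ^ (m - 1) * int ((m - 1) choose l)] (mod int p)"
proof -
  define b where "b = a - 1"
  define c F where "c = p ^ b" "F = (p - 1) * c"
  define k where "k = m - 1"
  have a: "a = Suc b" and m: "m = Suc k"
    using assms by (simp_all add: b_def k_def)
  have p: "p \<ge> 2" using assms(1) prime_ge_2_nat by blast
  have c: "c > 0" using p by (simp add: c_F_def)
  have pc: "p * c = c + F" using p by (cases p) (auto simp: c_F_def)
  have F: "F > 0" using p c by (simp add: c_F_def)
  have tot: "totient (p ^ a) = F"
    using totient_prime_power_Suc[OF assms(1), of b] by (simp add: a c_F_def mult.commute)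
  have n: "n = (l + 1) * c - 1 + Suc k * F"
    using assms(4) tot by (simp add: m c_F_def b_def)
  define W where "W = weighted_sum (binomial_weight (p ^ a) l) ([:-1, 1:] ^ n) r"
  have W: "[W = (- 1) ^ (k - l) * int (k choose l) * int p ^ (k - l)] (mod int p ^ (Suc k - l))"
    unfolding W_def n using weighted_sum_linear_power_cong[OF assms(1), of b l k r]
    by (simp add: a c_F_def)
  \<comment> \<open>The numerator is \<open>(k - l + 1) * F - 1\<close>, so the quotient just misses
    \<open>k - l + 1\<close>.\<close>
  have "\<lfloor>(of_nat n - of_nat (p ^ (a - 1)) - of_nat (l * p ^ a)) / (of_nat (totient (p ^ a)) :: rat)\<rfloor>
      = int k - int l"
  proof -
    have "n + 1 = (l + 1) * c + Suc k * F"
      using c by (simp add: n)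
    hence "(of_nat (n + 1) :: rat) = of_nat ((l + 1) * c + Suc k * F)"
      by (simp only:)
    moreover have "(of_nat (l * p ^ a) :: rat) = of_nat (l * (c + F))"
      unfolding pc[symmetric] by (simp add: a c_F_def(1))
    ultimately have "(of_nat n - of_nat (p ^ (a - 1)) - of_nat (l * p ^ a) :: rat)
        = (of_nat k - of_nat l + 1) * of_nat F - 1"
      by (simp add: algebra_simps a c_F_def(1))
    thus ?thesis
      unfolding tot floor_eq_iff using F by (simp add: field_simps)
  qed
  hence bracket: "fleck_bracket p a l n r = of_nat p powi (int l - int k) * of_int ((- 1) ^ n * W)"
    using assms(1) by (simp add: fleck_bracket_eq_weighted_sum W_def)
  show ?thesis
  proof (cases "l \<le> k")
    case False
    \<comment> \<open>The bracket now has a positive power of \<open>p\<close> in front, and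
      \<open>k choose l\<close> is 0.\<close>
    define z where "z = int p ^ (l - k) * ((- 1) ^ n * W)"
    have "fleck_bracket p a l n r = of_int z"
      using False by (simp add: bracket z_def power_int_def nat_diff_distrib)
    moreover have "[z = 0] (mod int p)"
      using False by (simp add: z_def cong_0_iff)
    ultimately show ?thesis
      using False by (auto simp: m binomial_eq_0 intro!: exI[of _ z])
  next
    case True
    \<comment> \<open>The modulus has one more factor \<open>p\<close> than the leading term, so
      dividing by \<open>p ^ (k - l)\<close> leaves a congruence modulo \<open>p\<close>.\<close>
    have "int p ^ (Suc k - l) dvd W - (- 1) ^ (k - l) * int (k choose l) * int p ^ (k - l)"
      using W by (simp add: cong_iff_dvd_diff)
    then obtain t where
      "W - (- 1) ^ (k - l) * int (k choose l) * int p ^ (k - l) = int p ^ (Suc k - l) * t"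
      by (elim dvdE)
    hence t: "W = int p ^ (k - l) * ((- 1) ^ (k - l) * int (k choose l) + int p * t)"
      using True by (simp add: Suc_diff_le algebra_simps)
    define z where "z = (- 1) ^ n * ((- 1) ^ (k - l) * int (k choose l) + int p * t)"
    have "(of_nat p :: rat) powi (int l - int k) * of_nat p ^ (k - l) = 1"
    proof -
      have "(of_nat p :: rat) ^ (k - l) = of_nat p powi (int k - int l)"
        using True by (simp add: power_int_def nat_diff_distrib)
      thus ?thesis
        using p by (simp flip: power_int_add)
    qed
    hence "fleck_bracket p a l n r = of_int z"
      by (simp add: bracket t z_def mult_ac)
    moreover have "[z = (- 1) ^ k * int (k choose l)] (mod int p)"
    proof -
      \<comment> \<open>Signs agree modulo 2; for odd \<open>p\<close>, \<open>c\<close> is odd and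
        \<open>F\<close> even, so \<open>n\<close> has the parity of \<open>l\<close>.\<close>
      have "[(- 1) ^ n * (- 1) ^ (k - l) = (- 1 :: int) ^ k] (mod int p)"
      proof (cases "p = 2")
        case True
        thus ?thesis by (simp add: cong_def mod_2_eq_odd)
      next
        case False
        hence "odd p" using assms(1) p prime_odd_nat[of p] by simp
        hence "odd c" "even F" by (auto simp: c_F_def)
        hence "even n \<longleftrightarrow> even l" using c by (simp add: n)
        hence "(- 1) ^ n * (- 1) ^ (k - l) = (- 1 :: int) ^ k"
          using True by (auto simp: minus_one_power_iff)
        thus ?thesis by simp
      qed
      hence "[(- 1) ^ n * (- 1) ^ (k - l) * int (k choose l) + int p * ((- 1) ^ n * t)
          = (- 1) ^ k * int (k choose l) + 0] (mod int p)"
        by (intro cong_add cong_mult cong_refl) (simp_all add: cong_0_iff)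
      thus ?thesis by (simp add: z_def algebra_simps)
    qed
    ultimately show ?thesis
      by (auto simp: m)
  qed
qed

end
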